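(* Let $A^*$ be a closed and densely defined operator on a complex Hilbert space $\mathcal{H}$. Then there is a one-to-one correspondence between all densely defined and closed restrictions of $A^*$ and all linear subspaces $\mathcal{L}\subset\mathcal{H}_{-1}$ that are closed with respect to $\|\cdot\|_{-1}$ and that satisfy $\mathcal{L}\cap\mathcal{H}=\{0\}$. This correspondence is given via $\mathcal{L}\mapsto A_\mathcal{L}'$, where $$\mathcal{D}(A_\mathcal{L}')=\{f\in\mathcal{D}(A^* ): \ell(f)=0\ \text{ for all }\ \ell\in \mathcal{L}\},\qquad A_\mathcal{L}'=A^*\upharpoonright_{\mathcal{D}(A_\mathcal{L}')}.$$
   Context: The scalar product $\langle\cdot,\cdot\rangle$ on $\mathcal{H}$ is antilinear in the first and linear in the second component. $A$ denotes the closed densely defined operator $A=(A^* )^*$, whose adjoint is the given operator $A^*$. By von Neumann's theorem $AA^*$ is nonnegative and selfadjoint. $\mathcal{H}_{+1}$ is the Hilbert space $\mathcal{D}(A^* )=\mathcal{D}((\mathbf{1}+AA^* )^{1/2})$ equipped with the inner product $\langle f,g\rangle_{+1}=\langle f,g\rangle+\langle A^*f,A^*g\rangle=\langle (\mathbf{1}+AA^* )^{1/2}f,(\mathbf{1}+AA^* )^{1/2}g\rangle$. $\mathcal{H}_{-1}$ is the completion of $\mathcal{H}$ with respect to the norm $\|\cdot\|_{-1}$ induced by $\langle f,g\rangle_{-1}=\langle (\mathbf{1}+AA^* )^{-1/2}f,(\mathbf{1}+AA^* )^{-1/2}g\rangle$, $f,g\in\mathcal{H}$, so that $\mathcal{H}_{+1}\subset\mathcal{H}\subset\mathcal{H}_{-1}$.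 $\mathcal{H}_{-1}$ is identified with the space $\mathcal{H}_{+1}^*$ of bounded linear functionals on $\mathcal{H}_{+1}$ as follows: if $\ell\in\mathcal{H}_{-1}$ is the $\|\cdot\|_{-1}$-limit of a sequence $\{\ell_n\}\subset\mathcal{H}$, then $\ell(f)=\lim_{n\to\infty}\langle \ell_n,f\rangle$ for $f\in\mathcal{H}_{+1}$; in particular $\ell\in\mathcal{H}$ acts as $\ell(f)=\langle \ell,f\rangle$. Restrictions of $A^*$ include $A^*$ itself. *)

theory Defs
  imports "HOL-Analysis.Analysis"
begin

section \<open>Complex Hilbert spaces\<close>

text \<open>The norm axiom makes the scalar product positive definite and the norm the induced one.
  The scalar product is antilinear in the first and linear in the second component.\<close>

class complex_inner = real_normed_vector +
  fixes scaleC :: "complex \<Rightarrow> 'a \<Rightarrow> 'a" (infixr "*\<^sub>C" 75)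
    and cinner :: "'a \<Rightarrow> 'a \<Rightarrow> complex"
  assumes scaleC_add_right: "c *\<^sub>C (x + y) = c *\<^sub>C x + c *\<^sub>C y"
    and scaleC_add_left: "(c + d) *\<^sub>C x = c *\<^sub>C x + d *\<^sub>C x"
    and scaleC_scaleC: "c *\<^sub>C (d *\<^sub>C x) = (c * d) *\<^sub>C x"
    and scaleR_scaleC: "r *\<^sub>R x = complex_of_real r *\<^sub>C x"
    and cinner_commute: "cinner x y = cnj (cinner y x)"
    and cinner_add_right: "cinner x (y + z) = cinner x y + cinner x z"
    and cinner_scaleC_right: "cinner x (c *\<^sub>C y) = c * cinner x y"
    and cinner_self: "cinner x x = complex_of_real ((norm x)\<^sup>2)"

class chilbert_space = complex_inner + banach

lemma scaleC_one: "1 *\<^sub>C x = (x :: 'a::complex_inner)"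
  using scaleR_scaleC[of 1 x] by simp

global_interpretation complex_vector:
  vector_space "scaleC :: complex \<Rightarrow> 'a \<Rightarrow> 'a::complex_inner"
  by unfold_locales (simp_all add: scaleC_add_right scaleC_add_left scaleC_scaleC scaleC_one)

instantiation complex :: complex_inner
begin

definition "scaleC c (z :: complex) = c * z"
definition "cinner (w :: complex) z = cnj w * z"

instance
proof
  fix x :: complex
  show "cinner x x = complex_of_real ((norm x)\<^sup>2)"
    by (metis cinner_complex_def complex_norm_square mult.commute)
qed (simp_all add: scaleC_complex_def cinner_complex_def algebra_simps scaleR_conv_of_real)

end

instance complex :: chilbert_space ..

instantiation prod :: (complex_inner, complex_inner) complex_inner
begin

definition "scaleC c (p :: 'a \<times> 'b) = (c *\<^sub>C fst p, c *\<^sub>C snd p)"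
definition "cinner (p :: 'a \<times> 'b) q = cinner (fst p) (fst q) + cinner (snd p) (snd q)"

instance
proof
  fix x y :: "'a \<times> 'b"
  show "cinner x y = cnj (cinner y x)"
    using cinner_commute[of "fst x" "fst y"] cinner_commute[of "snd x" "snd y"]
    by (simp add: cinner_prod_def)
  show "cinner x x = complex_of_real ((norm x)\<^sup>2)"
    by (simp add: cinner_prod_def norm_prod_def cinner_self)
qed (simp_all add: scaleC_prod_def cinner_prod_def scaleC_add_right scaleC_add_left scaleC_scaleC
      scaleR_prod_def scaleR_scaleC cinner_add_right cinner_scaleC_right algebra_simps)

end

instance prod :: (chilbert_space, chilbert_space) chilbert_space ..


section \<open>Unbounded operators\<close>

text \<open>An operator in a Hilbert space is represented by its graph. Thus \<^term>\<open>Domain T\<close> is its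
  domain, \<^term>\<open>B \<subseteq> T\<close> says that \<^term>\<open>B\<close> is a restriction of \<^term>\<open>T\<close>,
  \<^term>\<open>closed T\<close> says that \<^term>\<open>T\<close> is closed, \<^term>\<open>T\<inverse>\<close> is the inverse, and the
  product \<open>S T\<close> (first \<open>T\<close>, then \<open>S\<close>) is \<^term>\<open>T O S\<close>.\<close>

definition linear_operator :: "('a::complex_inner \<times> 'a) set \<Rightarrow> bool" where
  "linear_operator T \<longleftrightarrow> complex_vector.subspace T \<and> single_valued T"

definition densely_defined :: "('a::complex_inner \<times> 'a) set \<Rightarrow> bool" where
  "densely_defined T \<longleftrightarrow> closure (Domain T) = UNIV"

definition op_apply :: "('a \<times> 'a) set \<Rightarrow> 'a \<Rightarrow> 'a" where
  "op_apply T f = (THE g. (f, g) \<in> T)"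

definition adjoint_op :: "('a::complex_inner \<times> 'a) set \<Rightarrow> ('a \<times> 'a) set" where
  "adjoint_op T = {(g, h). \<forall>(f, k) \<in> T. cinner g k = cinner h f}"

definition one_plus :: "('a::complex_inner \<times> 'a) set \<Rightarrow> ('a \<times> 'a) set" where
  "one_plus T = {(f, f + g) | f g. (f, g) \<in> T}"

definition selfadjoint_op :: "('a::complex_inner \<times> 'a) set \<Rightarrow> bool" where
  "selfadjoint_op T \<longleftrightarrow> linear_operator T \<and> densely_defined T \<and> adjoint_op T = T"

definition nonneg_op :: "('a::complex_inner \<times> 'a) set \<Rightarrow> bool" where
  "nonneg_op T \<longleftrightarrow> (\<forall>(f, g) \<in> T. cinner f g \<in> \<real>\<^sub>\<ge>\<^sub>0)"

text \<open>A nonnegative selfadjoint operator has exactly one nonnegative selfadjoint square root.\<close>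

definition sqrt_op :: "('a::complex_inner \<times> 'a) set \<Rightarrow> ('a \<times> 'a) set" where
  "sqrt_op T = (THE S. selfadjoint_op S \<and> nonneg_op S \<and> S O S = T)"


section \<open>The space \<open>\<H>\<^sub>-\<^sub>1\<close>\<close>

text \<open>Throughout, \<open>Astar\<close> is the given operator \<open>A\<^sup>*\<close>, so that \<open>A\<close> is
  \<^term>\<open>adjoint_op Astar\<close> and \<open>A A\<^sup>*\<close> is \<^term>\<open>Astar O adjoint_op Astar\<close>.\<close>

definition cinner_minus1 :: "('a::complex_inner \<times> 'a) set \<Rightarrow> 'a \<Rightarrow> 'a \<Rightarrow> complex" where
  "cinner_minus1 Astar f g =
    (let R = (sqrt_op (one_plus (Astar O adjoint_op Astar)))\<inverse>
     in cinner (op_apply R f) (op_apply R g))"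

text \<open>The completion \<open>\<H>\<^sub>-\<^sub>1\<close>, unique up to unitary equivalence, depends on \<open>A\<^sup>*\<close> and hence is
  given as an arbitrary complete space \<^typ>\<open>'b\<close> together with a dense isometric embedding
  \<open>\<iota>\<close> of \<open>\<H>\<close> equipped with \<open>\<langle>\<cdot>,\<cdot>\<rangle>\<^sub>-\<^sub>1\<close>; the subset \<open>\<H>\<close> of \<open>\<H>\<^sub>-\<^sub>1\<close> is \<^term>\<open>range \<iota>\<close>.
  Such a completion always exists: \<open>\<H>\<close> itself, with \<open>\<iota> = (1 + A A\<^sup>*)\<^sup>-\<^sup>1\<^sup>/\<^sup>2\<close>.\<close>

definition is_completion_minus1 ::
  "('a::chilbert_space \<times> 'a) set \<Rightarrow> ('a \<Rightarrow> 'b::chilbert_space) \<Rightarrow> bool" where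
  "is_completion_minus1 Astar \<iota> \<longleftrightarrow>
    Vector_Spaces.linear scaleC scaleC \<iota> \<and>
    (\<forall>f g. cinner (\<iota> f) (\<iota> g) = cinner_minus1 Astar f g) \<and>
    closure (range \<iota>) = UNIV"

text \<open>The value \<open>\<ell>(f)\<close>, for \<open>f\<close> in the domain of \<open>A\<^sup>*\<close>: the common limit of
  \<open>\<langle>\<ell>\<^sub>n, f\<rangle>\<close> over all sequences \<open>\<ell>\<^sub>n\<close> in \<open>\<H>\<close> that converge to \<open>\<ell>\<close> in \<open>\<H>\<^sub>-\<^sub>1\<close>.\<close>

definition functional_value ::
  "('a::chilbert_space \<Rightarrow> 'b::chilbert_space) \<Rightarrow> 'b \<Rightarrow> 'a \<Rightarrow> complex" where
  "functional_value \<iota> l f =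
    (THE c. \<forall>X. (\<lambda>n. \<iota> (X n)) \<longlonglongrightarrow> l \<longrightarrow> (\<lambda>n. cinner (X n) f) \<longlonglongrightarrow> c)"

definition restriction_domain ::
  "('a::chilbert_space \<times> 'a) set \<Rightarrow> ('a \<Rightarrow> 'b::chilbert_space) \<Rightarrow> 'b set \<Rightarrow> 'a set" where
  "restriction_domain Astar \<iota> L = {f \<in> Domain Astar. \<forall>l\<in>L. functional_value \<iota> l f = 0}"

definition restriction_op ::
  "('a::chilbert_space \<times> 'a) set \<Rightarrow> ('a \<Rightarrow> 'b::chilbert_space) \<Rightarrow> 'b set \<Rightarrow> ('a \<times> 'a) set" where
  "restriction_op Astar \<iota> L = {(f, g) \<in> Astar. f \<in> restriction_domain Astar \<iota> L}"

end

theory Submission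
  imports Defs
begin

text \<open>Write \<open>G\<close> for the graph of \<open>A\<^sup>*\<close> with the scalar product of \<open>\<H> \<times> \<H>\<close>, which is that of \<open>\<H>\<^sub>+\<^sub>1\<close>.
  Projecting \<open>(x, 0)\<close> onto \<open>G\<close> gives a point \<open>k x\<close> over \<open>K x = (1 + A A\<^sup>*)\<^sup>-\<^sup>1 x\<close> with
  \<open>\<langle>k x, (f, A\<^sup>* f)\<rangle> = \<langle>x, f\<rangle>\<close>. Since \<open>K\<close> is a positive contraction, it has a unique positive square
  root \<open>Q\<close>, and \<open>Q\<^sup>-\<^sup>1\<close> is the square root of \<open>1 + A A\<^sup>*\<close>; hence
  \<open>\<langle>x, y\<rangle>\<^sub>-\<^sub>1 = \<langle>x, K y\<rangle> = \<langle>k x, k y\<rangle>\<close>. As the range of \<open>k\<close> is dense in \<open>G\<close>, the map \<open>x \<mapsto> k x\<close>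
  extends to a unitary \<open>W\<close> from \<open>\<H>\<^sub>-\<^sub>1\<close> onto \<open>G\<close> with \<open>\<ell>(f) = \<langle>W \<ell>, (f, A\<^sup>* f)\<rangle>\<close>. So the graph of
  \<open>A'\<^sub>\<L>\<close> is the orthogonal complement of \<open>W \<L>\<close> in \<open>G\<close>, and the correspondence is the one between
  closed subspaces of \<open>G\<close> and their complements. The complement of a restriction contains \<open>k x\<close>
  precisely when \<open>x\<close> is orthogonal to the domain of the restriction, so the latter is densely
  defined iff \<open>\<L>\<close> meets \<open>\<H>\<close> only in \<open>0\<close>.\<close>

section \<open>Geometry of complex Hilbert spaces\<close>

lemma cinner_add_left: "cinner (x + y) z = cinner x z + cinner y (z::'a::complex_inner)"
  by (metis cinner_add_right cinner_commute complex_cnj_add)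

lemma cinner_scaleC_left: "cinner (c *\<^sub>C x) y = cnj c * cinner x (y::'a::complex_inner)"
  by (metis cinner_commute cinner_scaleC_right complex_cnj_mult)

lemma cinner_scaleR_right: "cinner x (r *\<^sub>R y) = r *\<^sub>R cinner x (y::'a::complex_inner)"
  by (simp add: scaleR_scaleC cinner_scaleC_right scaleC_complex_def)

lemma cinner_scaleR_left: "cinner (r *\<^sub>R x) y = r *\<^sub>R cinner x (y::'a::complex_inner)"
  by (simp add: scaleR_scaleC cinner_scaleC_left scaleC_complex_def)

lemma Re_cinner_self: "Re (cinner x x) = (norm (x::'a::complex_inner))\<^sup>2"
  by (simp add: cinner_self)

lemma norm_scaleC: "norm (c *\<^sub>C x) = cmod c * norm (x::'a::complex_inner)"
proof (rule power2_eq_imp_eq)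
  have "complex_of_real ((norm (c *\<^sub>C x))\<^sup>2) = c * cnj c * complex_of_real ((norm x)\<^sup>2)"
    unfolding cinner_self[symmetric] by (simp add: cinner_scaleC_left cinner_scaleC_right)
  then show "(norm (c *\<^sub>C x))\<^sup>2 = (cmod c * norm x)\<^sup>2"
    by (metis complex_norm_square of_real_eq_iff of_real_mult power_mult_distrib)
qed simp_all

lemma norm_add_square:
  "(norm (x + y))\<^sup>2 = (norm x)\<^sup>2 + 2 * Re (cinner x y) + (norm (y::'a::complex_inner))\<^sup>2"
proof -
  have "Re (cinner y x) = Re (cinner x y)"
    by (metis cinner_commute cnj.simps(1))
  then show ?thesis
    by (simp add: Re_cinner_self[symmetric] cinner_add_left cinner_add_right)
qed

text \<open>The triangle inequality comes with the norm, so expanding the square of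
  \<open>norm (x + z)\<close> bounds the real part of \<open>cinner x z\<close>; a change of phase
  then turns the real part into the modulus.\<close>

lemma cinner_Cauchy_Schwarz: "cmod (cinner x y) \<le> norm x * norm (y::'a::complex_inner)"
proof -
  have re: "Re (cinner x z) \<le> norm x * norm z" for z
  proof -
    have "(norm (x + z))\<^sup>2 \<le> (norm x + norm z)\<^sup>2"
      by (intro power_mono norm_triangle_ineq) simp
    then show ?thesis
      by (simp add: norm_add_square power2_sum)
  qed
  \<comment> \<open>This phase makes \<open>cinner x (c *\<^sub>C y)\<close> equal to the modulus of
    \<open>cinner x y\<close>. If \<open>cinner x y = 0\<close>, then \<open>sgn\<close> returns
    \<open>0\<close> and so \<open>c = 0\<close>, hence only an upper bound on the norm of
    \<open>c *\<^sub>C y\<close> is claimed.\<close>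
  define c where "c = cnj (sgn (cinner x y))"
  have "Re (cinner x (c *\<^sub>C y)) = cmod (cinner x y)"
  proof (cases "cinner x y = 0")
    case False
    have "c * cinner x y = complex_of_real (cmod (cinner x y))"
      using False complex_norm_square[of "cinner x y"]
      by (simp add: c_def sgn_div_norm field_simps scaleR_conv_of_real power2_eq_square)
    then show ?thesis
      by (simp add: cinner_scaleC_right)
  qed (simp add: cinner_scaleC_right)
  moreover have "norm (c *\<^sub>C y) \<le> norm y"
    by (simp add: norm_scaleC c_def norm_sgn)
  ultimately show ?thesis
    using re[of "c *\<^sub>C y"] mult_left_mono[of "norm (c *\<^sub>C y)" "norm y" "norm x"] by simp
qed

text \<open>Over the real scalars the sesquilinear form is bilinear; this provides the rules for
  limits, continuity and differences.\<close>

interpretation cinner: bounded_bilinear "cinner :: 'a::complex_inner \<Rightarrow> 'a \<Rightarrow> complex"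
proof
  show "\<exists>K. \<forall>(a::'a) b. cmod (cinner a b) \<le> norm a * norm b * K"
    by (rule exI[of _ 1]) (simp add: cinner_Cauchy_Schwarz)
qed (simp_all add: cinner_add_left cinner_add_right cinner_scaleR_left cinner_scaleR_right)

declare cinner.zero_left [simp] cinner.zero_right [simp]

lemma cinner_eq_zero_iff: "cinner x x = 0 \<longleftrightarrow> x = (0::'a::complex_inner)"
  by (simp add: cinner_self)

lemma cinner_commute_zero: "cinner x y = 0 \<longleftrightarrow> cinner y (x::'a::complex_inner) = 0"
  by (metis cinner_commute complex_cnj_zero_iff)

lemma parallelogram:
  "(norm (x + y))\<^sup>2 + (norm (x - y))\<^sup>2 = 2 * (norm x)\<^sup>2 + 2 * (norm (y::'a::complex_inner))\<^sup>2"
  using norm_add_square[of x y] norm_add_square[of x "- y"] by (simp add: cinner.minus_right)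

lemma cinner_ext:
  assumes "\<And>z. cinner z x = cinner z (y::'a::complex_inner)"
  shows "x = y"
  using assms[of "x - y"] cinner_eq_zero_iff[of "x - y"] by (simp add: cinner.diff_right)

section \<open>Subspaces, orthogonal complements and the projection theorem\<close>

lemma subspaceD:
  assumes "complex_vector.subspace (M::'a::complex_inner set)"
  shows "0 \<in> M" "\<And>x y. x \<in> M \<Longrightarrow> y \<in> M \<Longrightarrow> x + y \<in> M" "\<And>x y. x \<in> M \<Longrightarrow> y \<in> M \<Longrightarrow> x - y \<in> M"
    "\<And>c x. x \<in> M \<Longrightarrow> c *\<^sub>C x \<in> M" "\<And>r x. x \<in> M \<Longrightarrow> r *\<^sub>R x \<in> M"
  using assms
  by (auto simp: complex_vector.subspace_0 complex_vector.subspace_add complex_vector.subspace_diff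
      complex_vector.subspace_scale scaleR_scaleC)

definition orthogonal_complement :: "'a::complex_inner set \<Rightarrow> 'a set" where
  "orthogonal_complement S = {y. \<forall>x\<in>S. cinner x y = 0}"

lemma subspace_orthogonal_complement:
  "complex_vector.subspace (orthogonal_complement (S::'a::complex_inner set))"
  by (rule complex_vector.subspaceI)
    (auto simp: orthogonal_complement_def cinner_add_right cinner_scaleC_right)

lemma closed_orthogonal_complement: "closed (orthogonal_complement (S::'a::complex_inner set))"
proof -
  have "orthogonal_complement S = (\<Inter>x\<in>S. {y. cinner x y = 0})"
    by (auto simp: orthogonal_complement_def)
  then show ?thesis
    by (simp add: closed_INT closed_Collect_eq cinner.continuous_on)
qed

lemma subspace_Domain:
  fixes T :: "('a::complex_inner \<times> 'a) set"
  assumes "complex_vector.subspace T"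
  shows "complex_vector.subspace (Domain T)"
proof (rule complex_vector.subspaceI)
  show "0 \<in> Domain T"
    using subspaceD(1)[OF assms] by (auto simp: zero_prod_def)
  show "x + y \<in> Domain T" if "x \<in> Domain T" "y \<in> Domain T" for x y
    using that subspaceD(2)[OF assms] by fastforce
  show "c *\<^sub>C x \<in> Domain T" if "x \<in> Domain T" for c x
    using that subspaceD(4)[OF assms] by (fastforce simp: scaleC_prod_def)
qed

text \<open>A minimizing sequence is Cauchy by the parallelogram law: the midpoint of two of its
  members lies in \<open>M\<close>, so it is no closer to \<open>x\<close> than the infimum.\<close>

lemma nearest_point_exists:
  fixes M :: "'a::chilbert_space set"
  assumes M: "complex_vector.subspace M" "closed M"
  obtains m where "m \<in> M" "\<And>z. z \<in> M \<Longrightarrow> norm (x - m) \<le> norm (x - z)"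
proof -
  define D where "D = (\<lambda>z. (norm (x - z))\<^sup>2) ` M"
  define d where "d = Inf D"
  have D: "D \<noteq> {}" "bdd_below D"
    using subspaceD(1)[OF M(1)] by (auto simp: D_def intro!: bdd_belowI[of _ 0])
  have d_le: "d \<le> (norm (x - z))\<^sup>2" if "z \<in> M" for z
    unfolding d_def by (rule cInf_lower) (use D that in \<open>auto simp: D_def\<close>)
  have "\<exists>z\<in>M. (norm (x - z))\<^sup>2 < d + 1 / Suc n" for n
    using cInf_lessD[of D "d + 1 / Suc n"] D(1) by (auto simp: d_def D_def)
  then obtain z where z: "\<And>n. z n \<in> M" "\<And>n. (norm (x - z n))\<^sup>2 < d + 1 / Suc n"
    by metis
  have close: "(norm (z m - z n))\<^sup>2 \<le> 2 / Suc m + 2 / Suc n" for m n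
  proof -
    have "d \<le> (norm (x - (1/2) *\<^sub>R (z m + z n)))\<^sup>2"
      by (intro d_le subspaceD[OF M(1)] z)
    also have "x - (1/2) *\<^sub>R (z m + z n) = (1/2) *\<^sub>R ((x - z m) + (x - z n))"
    proof -
      have "(1/2) *\<^sub>R ((x - z m) + (x - z n)) = (1/2) *\<^sub>R (x + x) - (1/2) *\<^sub>R (z m + z n)"
        by (simp only: scaleR_add_right scaleR_diff_right) simp
      then show ?thesis
        by simp
    qed
    also have "(norm \<dots>)\<^sup>2 = (norm ((x - z m) + (x - z n)))\<^sup>2 / 4"
      by (simp add: power2_eq_square)
    finally show ?thesis
      using parallelogram[of "x - z m" "x - z n"] z(2)[of m] z(2)[of n]
      by (simp add: norm_minus_commute)
  qed
  have "Cauchy z"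
  proof (rule metric_CauchyI)
    fix e :: real assume "e > 0"
    \<comment> \<open>From this index on, each of the two terms \<open>2 / Suc k\<close> in
      \<open>close\<close> is below half of the square of \<open>e\<close>.\<close>
    then obtain N where N: "4 / e\<^sup>2 < real N"
      using reals_Archimedean2 by blast
    have "dist (z m) (z n) < e" if "m \<ge> N" "n \<ge> N" for m n
    proof -
      have "2 / real (Suc k) < e\<^sup>2 / 2" if "k \<ge> N" for k
      proof -
        have "4 / e\<^sup>2 < real (Suc k)"
          using N that by linarith
        then show ?thesis
          using \<open>e > 0\<close> by (simp add: field_simps)
      qed
      from this[OF that(1)] this[OF that(2)] have "(norm (z m - z n))\<^sup>2 < e\<^sup>2"
        using close[of m n] by linarith
      then show ?thesis
        using \<open>e > 0\<close> by (simp add: dist_norm power2_less_imp_less)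
    qed
    then show "\<exists>N. \<forall>m\<ge>N. \<forall>n\<ge>N. dist (z m) (z n) < e"
      by blast
  qed
  then obtain m where m: "z \<longlonglongrightarrow> m"
    using Cauchy_convergent_iff convergent_def by blast
  show thesis
  proof
    show "m \<in> M"
      using closed_sequentially[OF M(2) _ m] z(1) by blast
    fix w assume "w \<in> M"
    have "(\<lambda>n. d + 1 / Suc n) \<longlonglongrightarrow> d + 0"
      using LIMSEQ_inverse_real_of_nat by (intro tendsto_intros) (simp add: divide_inverse)
    moreover have "(\<lambda>n. (norm (x - z n))\<^sup>2) \<longlonglongrightarrow> (norm (x - m))\<^sup>2"
      by (intro tendsto_intros m)
    ultimately have "(norm (x - m))\<^sup>2 \<le> d + 0"
      using z(2) by (elim LIMSEQ_le[rotated]) (auto intro: less_imp_le)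
    then show "norm (x - m) \<le> norm (x - w)"
      using d_le[OF \<open>w \<in> M\<close>] by (auto intro: power2_le_imp_le[OF order_trans])
  qed
qed

text \<open>The nearest point works: if the residual were not orthogonal to \<open>z\<close>, moving
  along \<open>z\<close> would come closer.\<close>

lemma orthogonal_projection_exists:
  fixes M :: "'a::chilbert_space set"
  assumes M: "complex_vector.subspace M" "closed M"
  obtains m where "m \<in> M" "\<And>z. z \<in> M \<Longrightarrow> cinner z (x - m) = 0"
proof -
  obtain m where m: "m \<in> M" "\<And>z. z \<in> M \<Longrightarrow> norm (x - m) \<le> norm (x - z)"
    using nearest_point_exists[OF M] by blast
  have "cinner z (x - m) = 0" if "z \<in> M" for z
  proof (cases "z = 0")
    case False
    define b where "b = cinner z (x - m)"
    \<comment> \<open>The squared distance along the direction \<open>b *\<^sub>C z\<close> is a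
      quadratic polynomial in the real parameter, and \<open>t\<close> is its minimizer. The
      distance changes by \<open>t * (cmod b)\<^sup>2\<close> there, which cannot be negative,
      although \<open>t\<close> is.\<close>
    define t where "t = - 1 / (norm z)\<^sup>2"
    have "norm (x - m) \<le> norm (x - (m - (t * b) *\<^sub>C z))"
      using m that by (intro m(2) subspaceD[OF M(1)])
    then have "(norm (x - m))\<^sup>2 \<le> (norm ((x - m) + (t * b) *\<^sub>C z))\<^sup>2"
      by (simp add: algebra_simps)
    also have "cinner (x - m) ((t * b) *\<^sub>C z) = complex_of_real (t * (cmod b)\<^sup>2)"
      using complex_norm_square[of b] cinner_commute[of "x - m" z]
      by (simp add: cinner_scaleC_right b_def)
    then have "(norm ((x - m) + (t * b) *\<^sub>C z))\<^sup>2
        = (norm (x - m))\<^sup>2 + 2 * (t * (cmod b)\<^sup>2) + t\<^sup>2 * (cmod b)\<^sup>2 * (norm z)\<^sup>2"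
      by (simp add: norm_add_square norm_scaleC norm_mult power_mult_distrib)
    also have "t\<^sup>2 * (cmod b)\<^sup>2 * (norm z)\<^sup>2 = - t * (cmod b)\<^sup>2"
      using False by (simp add: t_def power2_eq_square field_simps)
    finally have "0 \<le> t * (cmod b)\<^sup>2"
      by simp
    moreover have "t < 0"
      using False by (simp add: t_def)
    ultimately have "(cmod b)\<^sup>2 \<le> 0"
      by (simp add: zero_le_mult_iff)
    then show ?thesis
      by (simp add: b_def)
  qed simp
  with m(1) that show thesis
    by blast
qed

text \<open>The closed subspace \<open>M\<close> is its own double complement relative to
  \<open>N\<close>: the residual of the projection of \<open>x\<close> onto \<open>M\<close> stays
  in \<open>N\<close> and is orthogonal both to \<open>M\<close> and to \<open>x\<close>, hence to
  itself. Below, \<open>N\<close> is either the whole space or the graph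
  \<open>Astar\<close>.\<close>

lemma double_orthogonal:
  fixes M N :: "'a::chilbert_space set"
  assumes "complex_vector.subspace M" "closed M" "M \<subseteq> N" "complex_vector.subspace N"
    and x: "x \<in> N" "\<And>y. y \<in> N \<Longrightarrow> (\<And>m. m \<in> M \<Longrightarrow> cinner m y = 0) \<Longrightarrow> cinner y x = 0"
  shows "x \<in> M"
proof -
  obtain m where m: "m \<in> M" "\<And>z. z \<in> M \<Longrightarrow> cinner z (x - m) = 0"
    using orthogonal_projection_exists[OF assms(1,2)] by blast
  have "x - m \<in> N"
    using assms m(1) by (auto intro: subspaceD)
  then have "cinner (x - m) x = 0"
    using x(2) m(2) by blast
  moreover have "cinner (x - m) m = 0"
    using m by (simp add: cinner_commute_zero)
  ultimately have "cinner (x - m) (x - m) = 0"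
    by (simp add: cinner.diff_right)
  with m(1) show ?thesis
    by (simp add: cinner_eq_zero_iff)
qed

lemma closure_subspace:
  fixes M :: "'a::complex_inner set"
  assumes "complex_vector.subspace M"
  shows "complex_vector.subspace (closure M)"
proof (rule complex_vector.subspaceI)
  show "0 \<in> closure M"
    using subspaceD(1)[OF assms] closure_subset by blast
  fix x y assume "x \<in> closure M" "y \<in> closure M"
  then obtain X Y where "\<And>n. X n \<in> M" "X \<longlonglongrightarrow> x" "\<And>n. Y n \<in> M" "Y \<longlonglongrightarrow> y"
    unfolding closure_sequential by metis
  then show "x + y \<in> closure M"
    unfolding closure_sequential
    by (intro exI[of _ "\<lambda>n. X n + Y n"]) (auto intro: tendsto_add subspaceD[OF assms])
next
  fix c x assume "x \<in> closure M"
  then obtain X where X: "\<And>n. X n \<in> M" "X \<longlonglongrightarrow> x"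
    unfolding closure_sequential by metis
  have "bounded_linear (\<lambda>x::'a. c *\<^sub>C x)"
    by (rule bounded_linear_intro[of _ "cmod c"])
      (simp_all add: scaleC_add_right scaleR_scaleC scaleC_scaleC norm_scaleC mult.commute)
  from bounded_linear.tendsto[OF this X(2)] X(1) show "c *\<^sub>C x \<in> closure M"
    unfolding closure_sequential
    by (intro exI[of _ "\<lambda>n. c *\<^sub>C X n"]) (auto intro: subspaceD[OF assms])
qed

text \<open>A vector orthogonal to a dense set is a limit of vectors orthogonal to it, hence
  orthogonal to itself. Conversely, the closure of \<open>M\<close> is its own double complement in
  the whole space.\<close>

lemma dense_iff_orthogonal_trivial:
  fixes M :: "'a::chilbert_space set"
  assumes M: "complex_vector.subspace M"
  shows "closure M = UNIV \<longleftrightarrow> (\<forall>x. (\<forall>m\<in>M. cinner x m = 0) \<longrightarrow> x = 0)"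
proof (intro iffI allI impI)
  fix x assume dense: "closure M = UNIV" and x: "\<forall>m\<in>M. cinner x m = 0"
  obtain X where X: "\<And>n. X n \<in> M" "X \<longlonglongrightarrow> x"
    using dense closure_sequential[of x M] by auto
  have "(\<lambda>n. cinner x (X n)) \<longlonglongrightarrow> cinner x x"
    by (intro cinner.tendsto tendsto_const X)
  then have "cinner x x = 0"
    using X(1) x by (simp add: LIMSEQ_const_iff)
  then show "x = 0"
    by (simp add: cinner_eq_zero_iff)
next
  assume triv: "\<forall>x. (\<forall>m\<in>M. cinner x m = 0) \<longrightarrow> x = 0"
  show "closure M = UNIV"
  proof (intro equalityI subsetI UNIV_I)
    fix x
    show "x \<in> closure M"
    proof (rule double_orthogonal[OF closure_subspace[OF M] closed_closure subset_UNIV])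
      fix y assume y: "\<And>m. m \<in> closure M \<Longrightarrow> cinner m y = 0"
      have "\<forall>m\<in>M. cinner y m = 0"
        using y closure_subset[of M] by (metis cinner_commute_zero subsetD)
      with triv have "y = 0"
        by blast
      then show "cinner y x = 0"
        by simp
    qed simp_all
  qed
qed

section \<open>Square roots of positive contractions\<close>

definition symmetric_map :: "('a::complex_inner \<Rightarrow> 'a) \<Rightarrow> bool" where
  "symmetric_map F \<longleftrightarrow> (\<forall>x y. cinner (F x) y = cinner x (F y))"

lemma symmetric_mapD: "symmetric_map F \<Longrightarrow> cinner (F x) y = cinner x (F y)"
  by (simp add: symmetric_map_def)

text \<open>Symmetry of an everywhere defined map forces linearity: moving \<open>F\<close> to the
  other side reduces each identity to one for the scalar product, which separates points.\<close>

lemma symmetric_map_linear: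
  assumes "symmetric_map F"
  shows symmetric_map_add: "F (x + y) = F x + F y"
    and symmetric_map_diff: "F (x - y) = F x - F y"
    and symmetric_map_scaleC: "F (c *\<^sub>C x) = c *\<^sub>C F x"
    and symmetric_map_scaleR: "F (r *\<^sub>R x) = r *\<^sub>R F x"
    and symmetric_map_zero: "F 0 = 0"
  by (rule cinner_ext; simp add: symmetric_mapD[OF assms, symmetric] cinner_add_right
      cinner.diff_right cinner_scaleC_right cinner_scaleR_right)+

lemma Im_symmetric_map:
  assumes "symmetric_map F"
  shows "Im (cinner x (F x)) = 0"
  using cinner_commute[of "F x" x] symmetric_mapD[OF assms, of x x] by (simp add: complex_eq_iff)

text \<open>Visser's iteration: a limit \<open>Y\<close> solves \<open>2 Y = N + Y\<^sup>2\<close>, so that \<open>(1 - Y)\<^sup>2 = 1 - N\<close>.\<close>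

primrec sqrt_iter :: "('a::complex_inner \<Rightarrow> 'a) \<Rightarrow> nat \<Rightarrow> 'a \<Rightarrow> 'a" where
  "sqrt_iter N 0 = (\<lambda>x. 0)"
| "sqrt_iter N (Suc n) = (\<lambda>x. (1/2) *\<^sub>R (N x + sqrt_iter N n (sqrt_iter N n x)))"

text \<open>The same iteration for the number \<open>1\<close>; its increments dominate those of \<open>sqrt_iter N\<close>
  in norm.\<close>

primrec sqrt_majorant :: "nat \<Rightarrow> real" where
  "sqrt_majorant 0 = 0"
| "sqrt_majorant (Suc n) = (1 + (sqrt_majorant n)\<^sup>2) / 2"

lemma sqrt_majorant_bounds: "0 \<le> sqrt_majorant n" "sqrt_majorant n \<le> 1"
  by (induction n) (auto simp: power_le_one)

lemma sqrt_majorant_mono: "sqrt_majorant n \<le> sqrt_majorant (Suc n)"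
proof -
  have "0 \<le> (1 - sqrt_majorant n)\<^sup>2"
    by simp
  then show ?thesis
    by (simp add: power2_diff)
qed

lemma summable_sqrt_majorant_increments:
  "summable (\<lambda>n. sqrt_majorant (Suc n) - sqrt_majorant n)"
proof -
  have "incseq sqrt_majorant"
    using sqrt_majorant_mono by (intro incseq_SucI)
  then obtain L where "sqrt_majorant \<longlonglongrightarrow> L"
    using sqrt_majorant_bounds(2) incseq_convergent[of sqrt_majorant 1] by blast
  then show ?thesis
    by (rule telescope_summable)
qed

lemma symmetric_sqrt_iter:
  assumes "symmetric_map N"
  shows "symmetric_map (sqrt_iter N n)"
proof (induction n)
  case 0
  then show ?case by (simp add: symmetric_map_def)
next
  case (Suc n)
  then show ?case
    using assms
    by (simp add: symmetric_map_def cinner_scaleR_left cinner_scaleR_right cinner_add_left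
        cinner_add_right)
qed

text \<open>The iterates are polynomials in \<open>N\<close>, so they commute with every linear map
  that commutes with \<open>N\<close>; symmetry of \<open>P\<close> enters through
  linearity.\<close>

lemma sqrt_iter_commute:
  assumes "symmetric_map P" "\<And>x. P (N x) = N (P x)"
  shows "P (sqrt_iter N n x) = sqrt_iter N n (P x)"
  by (induction n arbitrary: x)
    (simp_all add: assms(2) symmetric_map_linear[OF assms(1)])

lemma norm_sqrt_iter_le:
  assumes "\<And>x. norm (N x) \<le> norm x"
  shows "norm (sqrt_iter N n x) \<le> sqrt_majorant n * norm x"
proof (induction n arbitrary: x)
  case (Suc n)
  let ?Y = "sqrt_iter N n"
  have "norm (?Y (?Y x)) \<le> sqrt_majorant n * norm (?Y x)"
    by (rule Suc)
  also have "\<dots> \<le> sqrt_majorant n * (sqrt_majorant n * norm x)"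
    by (intro mult_left_mono Suc sqrt_majorant_bounds)
  finally have "norm (N x + ?Y (?Y x)) \<le> norm x + (sqrt_majorant n)\<^sup>2 * norm x"
    using assms[of x] by (intro norm_triangle_le) (simp add: power2_eq_square)
  moreover have "norm (sqrt_iter N (Suc n) x) = norm (N x + ?Y (?Y x)) / 2"
    by (simp only: sqrt_iter.simps norm_scaleR)
  ultimately show ?case
    by (simp add: field_simps)
qed simp

text \<open>For consecutive iterates \<open>Y\<close> and \<open>Z\<close>, with majorants
  \<open>b\<close> and \<open>c\<close>, write \<open>Z Z - Y Y = Z (Z - Y) + (Z - Y) Y\<close>. By
  induction its norm is at most \<open>c (c - b) + (c - b) b = c^2 - b^2\<close> times that of the
  argument, which is twice the next increment of the majorant.\<close>

lemma norm_sqrt_iter_increment_le: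
  assumes N: "symmetric_map N" "\<And>x. norm (N x) \<le> norm x"
  shows "norm (sqrt_iter N (Suc n) x - sqrt_iter N n x)
    \<le> (sqrt_majorant (Suc n) - sqrt_majorant n) * norm x"
proof (induction n arbitrary: x)
  case 0
  then show ?case
    using N(2)[of x] symmetric_map_zero[OF N(1)] by simp
next
  case (Suc n)
  let ?Y = "sqrt_iter N n" and ?Z = "sqrt_iter N (Suc n)"
  let ?b = "sqrt_majorant n" and ?c = "sqrt_majorant (Suc n)"
  have "norm (?Z (?Z x - ?Y x)) \<le> ?c * norm (?Z x - ?Y x)"
    by (rule norm_sqrt_iter_le[OF N(2)])
  also have "\<dots> \<le> ?c * ((?c - ?b) * norm x)"
    by (intro mult_left_mono Suc sqrt_majorant_bounds)
  finally have 1: "norm (?Z (?Z x - ?Y x)) \<le> ?c * ((?c - ?b) * norm x)" .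
  have "norm (?Z (?Y x) - ?Y (?Y x)) \<le> (?c - ?b) * norm (?Y x)"
    by (rule Suc)
  also have "\<dots> \<le> (?c - ?b) * (?b * norm x)"
    using sqrt_majorant_mono[of n] by (intro mult_left_mono norm_sqrt_iter_le N) simp
  finally have 2: "norm (?Z (?Y x) - ?Y (?Y x)) \<le> (?c - ?b) * (?b * norm x)" .
  have "sqrt_iter N (Suc (Suc n)) x - ?Z x = (1/2) *\<^sub>R (?Z (?Z x) - ?Y (?Y x))"
    unfolding sqrt_iter.simps(2)[of N "Suc n"]
    by (subst (3) sqrt_iter.simps(2)) (simp only: scaleR_diff_right[symmetric] add_diff_cancel_left)
  also have "?Z (?Z x) - ?Y (?Y x) = ?Z (?Z x - ?Y x) + (?Z (?Y x) - ?Y (?Y x))"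
    using symmetric_map_diff[OF symmetric_sqrt_iter[OF N(1)], of "Suc n" "?Z x" "?Y x"] by simp
  also have "norm ((1/2) *\<^sub>R \<dots>) \<le> (1/2) * (?c * ((?c - ?b) * norm x) + (?c - ?b) * (?b * norm x))"
    using norm_triangle_mono[OF 1 2] by simp
  also have "\<dots> = (?c\<^sup>2 - ?b\<^sup>2) / 2 * norm x"
    by (simp add: power2_eq_square algebra_simps del: sqrt_majorant.simps)
  also have "\<dots> = (sqrt_majorant (Suc (Suc n)) - ?c) * norm x"
    by (simp add: diff_divide_distrib add_divide_distrib)
  finally show ?case .
qed

text \<open>The increments are dominated by those of the bounded increasing majorant, so their
  series converges absolutely, and its partial sums telescope to the iterates.\<close>

lemma sqrt_iter_convergent:
  fixes N :: "'a::chilbert_space \<Rightarrow> 'a"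
  assumes N: "symmetric_map N" "\<And>x. norm (N x) \<le> norm x"
  shows "convergent (\<lambda>n. sqrt_iter N n x)"
proof -
  have "summable (\<lambda>n. sqrt_iter N (Suc n) x - sqrt_iter N n x)"
  proof (rule summable_comparison_test)
    show "\<exists>k. \<forall>n\<ge>k. norm (sqrt_iter N (Suc n) x - sqrt_iter N n x)
        \<le> (sqrt_majorant (Suc n) - sqrt_majorant n) * norm x"
      using norm_sqrt_iter_increment_le[OF N] by blast
    show "summable (\<lambda>n. (sqrt_majorant (Suc n) - sqrt_majorant n) * norm x)"
      by (intro summable_mult2 summable_sqrt_majorant_increments)
  qed
  from summable_LIMSEQ[OF this] show ?thesis
    by (simp only: sum_lessThan_telescope[of "\<lambda>n. sqrt_iter N n x"]) (auto simp: convergent_def)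
qed

text \<open>The second assumption says \<open>K^2 \<le> K\<close>, which packs positivity and
  contractivity into one inequality. The root is \<open>1 - Y\<close>, with \<open>Y\<close> the
  pointwise limit of the iteration for \<open>N = 1 - K\<close>. The commutation clause serves the
  uniqueness proof.\<close>

lemma positive_contraction_sqrt:
  fixes K :: "'a::chilbert_space \<Rightarrow> 'a"
  assumes K: "symmetric_map K" "\<And>x. (norm (K x))\<^sup>2 \<le> Re (cinner x (K x))"
  obtains Q where "symmetric_map Q" "\<And>x. 0 \<le> Re (cinner x (Q x))" "\<And>x. Q (Q x) = K x"
    "\<And>P x. symmetric_map P \<Longrightarrow> (\<And>x. norm (P x) \<le> norm x) \<Longrightarrow> (\<And>x. P (K x) = K (P x)) \<Longrightarrow>
      P (Q x) = Q (P x)"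
proof -
  define N where "N x = x - K x" for x
  have N: "symmetric_map N"
    using K(1) by (simp add: symmetric_map_def N_def cinner.diff_left cinner.diff_right)
  have N_le: "norm (N x) \<le> norm x" for x
  proof (rule power2_le_imp_le)
    have "(norm (N x))\<^sup>2 = (norm x)\<^sup>2 - 2 * Re (cinner x (K x)) + (norm (K x))\<^sup>2"
      using norm_add_square[of x "- K x"] by (simp add: N_def cinner.minus_right)
    moreover have "0 \<le> Re (cinner x (K x))"
      using K(2)[of x] by (rule order_trans[rotated]) simp
    ultimately show "(norm (N x))\<^sup>2 \<le> (norm x)\<^sup>2"
      using K(2)[of x] by linarith
  qed simp
  define Y where "Y x = lim (\<lambda>n. sqrt_iter N n x)" for x
  have Y: "(\<lambda>n. sqrt_iter N n x) \<longlonglongrightarrow> Y x" for x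
    unfolding Y_def using sqrt_iter_convergent[OF N N_le] by (simp add: convergent_LIMSEQ_iff)
  have Y_sym: "symmetric_map Y"
    unfolding symmetric_map_def
  proof (intro allI LIMSEQ_unique)
    fix x y
    show "(\<lambda>n. cinner (sqrt_iter N n x) y) \<longlonglongrightarrow> cinner (Y x) y"
      by (intro cinner.tendsto Y tendsto_const)
    show "(\<lambda>n. cinner (sqrt_iter N n x) y) \<longlonglongrightarrow> cinner x (Y y)"
      unfolding symmetric_mapD[OF symmetric_sqrt_iter[OF N]]
      by (intro cinner.tendsto Y tendsto_const)
  qed
  have iter_le: "norm (sqrt_iter N n x) \<le> norm x" for n x
    using norm_sqrt_iter_le[OF N_le, of n x] mult_right_mono[OF sqrt_majorant_bounds(2), of "norm x" n]
    by simp
  have Y_le: "norm (Y x) \<le> norm x" for x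
    using Lim_bounded[OF tendsto_norm[OF Y]] iter_le by blast
  \<comment> \<open>Multiplication is handled by writing the inner iterate as \<open>Y x\<close>
    plus an error; the outer iterates are contractions uniformly in \<open>n\<close>, so the error
    still tends to \<open>0\<close>.\<close>
  have YY: "(\<lambda>n. sqrt_iter N n (sqrt_iter N n x)) \<longlonglongrightarrow> Y (Y x)" for x
  proof -
    have "(\<lambda>n. sqrt_iter N n (sqrt_iter N n x - Y x)) \<longlonglongrightarrow> 0"
    proof (rule Lim_null_comparison)
      show "\<forall>\<^sub>F n in sequentially. norm (sqrt_iter N n (sqrt_iter N n x - Y x))
          \<le> norm (sqrt_iter N n x - Y x)"
        by (simp add: iter_le)
      show "(\<lambda>n. norm (sqrt_iter N n x - Y x)) \<longlonglongrightarrow> 0"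
        using Y LIM_zero tendsto_norm_zero by blast
    qed
    from tendsto_add[OF this Y[of "Y x"]] show ?thesis
      by (simp add: symmetric_map_diff[OF symmetric_sqrt_iter[OF N]])
  qed
  have Y_eq: "2 *\<^sub>R Y x = N x + Y (Y x)" for x
  proof -
    have "(\<lambda>n. sqrt_iter N (Suc n) x) \<longlonglongrightarrow> (1/2) *\<^sub>R (N x + Y (Y x))"
      unfolding sqrt_iter.simps by (intro tendsto_intros YY)
    from LIMSEQ_unique[OF LIMSEQ_Suc[OF Y] this]
    have "2 *\<^sub>R Y x = 2 *\<^sub>R ((1/2) *\<^sub>R (N x + Y (Y x)))"
      by (rule arg_cong)
    then show ?thesis
      by simp
  qed
  show thesis
  proof
    show "symmetric_map (\<lambda>x. x - Y x)"
      using Y_sym by (simp add: symmetric_map_def cinner.diff_left cinner.diff_right)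
    fix x
    have "Re (cinner x (Y x)) \<le> norm x * norm (Y x)"
      using complex_Re_le_cmod cinner_Cauchy_Schwarz order_trans by blast
    also have "\<dots> \<le> (norm x)\<^sup>2"
      using mult_left_mono[OF Y_le[of x], of "norm x"] by (simp add: power2_eq_square)
    finally show "0 \<le> Re (cinner x (x - Y x))"
      by (simp add: cinner.diff_right Re_cinner_self)
    show "x - Y x - Y (x - Y x) = K x"
      using Y_eq[of x] by (simp add: symmetric_map_diff[OF Y_sym] N_def scaleR_2 algebra_simps)
  next
    fix P :: "'a \<Rightarrow> 'a" and x
    assume P: "symmetric_map P" "\<And>x. norm (P x) \<le> norm x" "\<And>x. P (K x) = K (P x)"
    have "bounded_linear P"
      by (rule bounded_linear_intro[of _ 1]) (simp_all add: symmetric_map_linear[OF P(1)] P(2))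
    from bounded_linear.tendsto[OF this Y]
    have "(\<lambda>n. sqrt_iter N n (P x)) \<longlonglongrightarrow> P (Y x)"
      by (simp add: sqrt_iter_commute[OF P(1)] N_def symmetric_map_diff[OF P(1)] P(3))
    with Y[of "P x"] have "P (Y x) = Y (P x)"
      using LIMSEQ_unique by blast
    then show "P (x - Y x) = P x - Y (P x)"
      by (simp add: symmetric_map_diff[OF P(1)])
  qed
qed

section \<open>Uniqueness of the positive square root of a contraction\<close>

lemma norm_sqrt_le:
  assumes P: "symmetric_map P" "\<And>x. P (P x) = K x" and K: "\<And>x. norm (K x) \<le> norm x"
  shows "norm (P x) \<le> norm x"
proof (rule power2_le_imp_le)
  have "(norm (P x))\<^sup>2 = Re (cinner x (K x))"
    using symmetric_mapD[OF P(1), of x "P x"] by (simp add: P(2) Re_cinner_self[symmetric])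
  also have "\<dots> \<le> norm x * norm (K x)"
    using complex_Re_le_cmod cinner_Cauchy_Schwarz order_trans by blast
  also have "\<dots> \<le> (norm x)\<^sup>2"
    using mult_left_mono[OF K[of x], of "norm x"] by (simp add: power2_eq_square)
  finally show "(norm (P x))\<^sup>2 \<le> (norm x)\<^sup>2" .
qed simp

text \<open>Positivity is tested at \<open>y - P y\<close>.\<close>

lemma positive_contraction_null:
  assumes P: "symmetric_map P" "\<And>x. 0 \<le> Re (cinner x (P x))" "\<And>x. norm (P x) \<le> norm x"
    and "Re (cinner y (P y)) = 0"
  shows "P y = 0"
proof -
  let ?z = "P y"
  have "cinner (y - ?z) (P (y - ?z))
      = cinner y (P y) - cinner ?z ?z - cinner ?z ?z + cinner ?z (P ?z)"
    by (simp add: symmetric_map_diff[OF P(1)] cinner.diff_left cinner.diff_right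
        symmetric_mapD[OF P(1), symmetric])
  then have "2 * (norm ?z)\<^sup>2 \<le> Re (cinner ?z (P ?z))"
    using P(2)[of "y - ?z"] assms(4) by (simp add: Re_cinner_self)
  also have "\<dots> \<le> norm ?z * norm (P ?z)"
    using complex_Re_le_cmod cinner_Cauchy_Schwarz order_trans by blast
  also have "\<dots> \<le> (norm ?z)\<^sup>2"
    using mult_left_mono[OF P(3)[of ?z], of "norm ?z"] by (simp add: power2_eq_square)
  finally show ?thesis
    by simp
qed

text \<open>At \<open>y = P x - Q x\<close>, commutation gives
  \<open>(P + Q) y = (P^2 - Q^2) x = 0\<close>. Both quadratic forms are nonnegative, so both vanish
  at \<open>y\<close>; hence \<open>P y = Q y = 0\<close>, and moving \<open>P - Q\<close> across
  the scalar product shows that \<open>y\<close> is orthogonal to itself.\<close>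

lemma positive_sqrt_unique:
  assumes P: "symmetric_map P" "\<And>x. 0 \<le> Re (cinner x (P x))" "\<And>x. norm (P x) \<le> norm x"
    and Q: "symmetric_map Q" "\<And>x. 0 \<le> Re (cinner x (Q x))" "\<And>x. norm (Q x) \<le> norm x"
    and eq: "\<And>x. P (P x) = Q (Q x)" and comm: "\<And>x. P (Q x) = Q (P x)"
  shows "P x = Q x"
proof -
  define y where "y = P x - Q x"
  have "P y + Q y = 0"
    by (simp add: y_def symmetric_map_diff[OF P(1)] symmetric_map_diff[OF Q(1)] eq comm)
  then have "cinner y (P y) + cinner y (Q y) = 0"
    by (metis cinner_add_right cinner.zero_right)
  then have "Re (cinner y (P y)) + Re (cinner y (Q y)) = 0"
    by (metis plus_complex.sel(1) zero_complex.sel(1))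
  then have "Re (cinner y (P y)) = 0" "Re (cinner y (Q y)) = 0"
    using P(2)[of y] Q(2)[of y] by linarith+
  then have "P y = 0" "Q y = 0"
    using positive_contraction_null P Q by blast+
  then have "cinner (P x - Q x) y = 0"
    by (simp add: cinner.diff_left symmetric_mapD[OF P(1)] symmetric_mapD[OF Q(1)])
  then have "cinner y y = 0"
    by (simp add: y_def)
  then show ?thesis
    by (simp add: cinner_eq_zero_iff y_def)
qed

section \<open>Selfadjoint operators as inverses of injective symmetric maps, and their square
  roots\<close>

lemma selfadjoint_inverse_graph:
  fixes F :: "'a::chilbert_space \<Rightarrow> 'a"
  assumes F: "symmetric_map F" "\<And>x. F x = 0 \<Longrightarrow> x = 0"
  shows "selfadjoint_op (range (\<lambda>x. (F x, x)))"
proof -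
  let ?S = "range (\<lambda>x. (F x, x))"
  have "complex_vector.subspace ?S"
    by (rule complex_vector.subspaceI)
      (auto simp: image_iff zero_prod_def scaleC_prod_def symmetric_map_linear[OF F(1)])
  moreover have "single_valued ?S"
    unfolding single_valued_def
  proof clarsimp
    fix x y assume "F x = F y"
    then have "F (x - y) = 0"
      by (simp add: symmetric_map_diff[OF F(1)])
    then show "x = y"
      using F(2)[of "x - y"] by simp
  qed
  moreover have "closure (Domain ?S) = UNIV"
  proof -
    have "complex_vector.subspace (range F)"
    proof (rule complex_vector.subspaceI)
      show "0 \<in> range F"
        by (metis rangeI symmetric_map_zero[OF F(1)])
    qed (auto simp flip: symmetric_map_add[OF F(1)] symmetric_map_scaleC[OF F(1)])
    moreover have "x = 0" if "\<forall>m\<in>range F. cinner x m = 0" for x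
    proof -
      \<comment> \<open>Testing against this element of the range gives
        \<open>cinner (F x) (F x) = 0\<close> by symmetry.\<close>
      have "cinner x (F (F x)) = 0"
        using that by simp
      then have "F x = 0"
        using symmetric_mapD[OF F(1), of x "F x"] by (simp add: cinner_eq_zero_iff)
      with F(2) show ?thesis .
    qed
    moreover have "Domain ?S = range F"
      by auto
    ultimately show ?thesis
      by (simp add: dense_iff_orthogonal_trivial)
  qed
  moreover have "adjoint_op ?S = ?S"
  proof -
    have "(g, h) \<in> adjoint_op ?S \<longleftrightarrow> g = F h" for g h
    proof -
      have "(g, h) \<in> adjoint_op ?S \<longleftrightarrow> (\<forall>x. cinner g x = cinner (F h) x)"
        by (simp add: adjoint_op_def symmetric_mapD[OF F(1)])
      also have "\<dots> \<longleftrightarrow> g = F h"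
      proof
        assume "\<forall>x. cinner g x = cinner (F h) x"
        then have "cinner x g = cinner x (F h)" for x
          by (metis cinner_commute)
        then show "g = F h"
          by (rule cinner_ext)
      qed simp
      finally show ?thesis .
    qed
    then show ?thesis
      by auto
  qed
  ultimately show ?thesis
    by (simp add: selfadjoint_op_def linear_operator_def densely_defined_def)
qed

text \<open>Converse direction: a trivial kernel makes the preimage \<open>P x\<close> of
  \<open>x\<close> unique, and the inclusion of \<open>S\<close> in its adjoint, read on the pairs
  \<open>(P x, x)\<close>, is the symmetry of \<open>P\<close>.\<close>

lemma selfadjoint_surj_imp_inverse_graph:
  assumes S: "selfadjoint_op S" "\<And>x. (x, 0) \<in> S \<Longrightarrow> x = 0" "\<And>x. x \<in> Range S"
  obtains P where "S = range (\<lambda>x. (P x, x))" "symmetric_map P"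
proof -
  have sub: "complex_vector.subspace S"
    using S(1) by (simp add: selfadjoint_op_def linear_operator_def)
  have "\<forall>x. \<exists>y. (y, x) \<in> S"
    using S(3) by blast
  then obtain P where P: "\<And>x. (P x, x) \<in> S"
    by metis
  have "y = P x" if "(y, x) \<in> S" for x y
  proof -
    have "(y - P x, 0) \<in> S"
      using subspaceD(3)[OF sub that P[of x]] by simp
    then show ?thesis
      using S(2)[of "y - P x"] by simp
  qed
  then have "S = range (\<lambda>x. (P x, x))"
    using P by auto
  moreover have "cinner (P x) y = cinner x (P y)" for x y
  proof -
    have "(P x, x) \<in> adjoint_op S"
      using S(1) P by (simp add: selfadjoint_op_def)
    with P[of y] show ?thesis
      by (auto simp: adjoint_op_def)
  qed
  ultimately show thesis
    using that by (simp add: symmetric_map_def)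
qed

text \<open>The square root of the inverse of \<open>K\<close> is the inverse of \<open>Q\<close>. A
  competitor \<open>S\<close> inherits injectivity and surjectivity from \<open>S O S\<close>, so it
  is the inverse of a symmetric map \<open>P\<close> with square \<open>K\<close>, and the
  uniqueness of bounded positive roots applies.\<close>

lemma sqrt_op_inverse_graph:
  fixes K :: "'a::chilbert_space \<Rightarrow> 'a"
  assumes K: "symmetric_map K" "\<And>x. (norm (K x))\<^sup>2 \<le> Re (cinner x (K x))"
    and inj: "\<And>x. K x = 0 \<Longrightarrow> x = 0"
  obtains Q where "symmetric_map Q" "\<And>x. Q (Q x) = K x"
    "sqrt_op (range (\<lambda>x. (K x, x))) = range (\<lambda>x. (Q x, x))"
proof -
  have K_le: "norm (K x) \<le> norm x" for x
  proof -
    have "norm (K x) * norm (K x) \<le> Re (cinner x (K x))"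
      using K(2)[of x] by (simp add: power2_eq_square)
    also have "\<dots> \<le> norm x * norm (K x)"
      using complex_Re_le_cmod cinner_Cauchy_Schwarz order_trans by blast
    finally show ?thesis
      by (metis mult_right_le_imp_le norm_ge_zero order_le_less)
  qed
  obtain Q where Q: "symmetric_map Q" "\<And>x. 0 \<le> Re (cinner x (Q x))" "\<And>x. Q (Q x) = K x"
    and Q_comm: "\<And>P x. symmetric_map P \<Longrightarrow> (\<And>x. norm (P x) \<le> norm x) \<Longrightarrow>
      (\<And>x. P (K x) = K (P x)) \<Longrightarrow> P (Q x) = Q (P x)"
    using positive_contraction_sqrt[OF K] by blast
  have Q_inj: "x = 0" if "Q x = 0" for x
    using that Q(3)[of x] symmetric_map_zero[OF Q(1)] inj by simp
  have "sqrt_op (range (\<lambda>x. (K x, x))) = range (\<lambda>x. (Q x, x))"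
    unfolding sqrt_op_def
  proof (rule the_equality, intro conjI)
    show "selfadjoint_op (range (\<lambda>x. (Q x, x)))"
      by (rule selfadjoint_inverse_graph[OF Q(1) Q_inj])
    show "nonneg_op (range (\<lambda>x. (Q x, x)))"
    proof -
      have "cinner (Q x) x \<in> \<real>\<^sub>\<ge>\<^sub>0" for x
        using Q(2)[of x]
        by (simp add: symmetric_mapD[OF Q(1)] Im_symmetric_map[OF Q(1)] complex_nonneg_Reals_iff)
      then show ?thesis
        by (auto simp: nonneg_op_def)
    qed
    have "range (\<lambda>x. (Q x, x)) O range (\<lambda>x. (Q x, x)) = range (\<lambda>x. (Q (Q x), x))"
      by blast
    then show "range (\<lambda>x. (Q x, x)) O range (\<lambda>x. (Q x, x)) = range (\<lambda>x. (K x, x))"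
      by (simp only: Q(3))
  next
    fix S :: "('a \<times> 'a) set"
    assume "selfadjoint_op S \<and> nonneg_op S \<and> S O S = range (\<lambda>x. (K x, x))"
    then have S: "selfadjoint_op S" "nonneg_op S" "S O S = range (\<lambda>x. (K x, x))"
      by simp_all
    have "(0, 0) \<in> S"
      using S(1) complex_vector.subspace_0[of S]
      by (simp add: selfadjoint_op_def linear_operator_def zero_prod_def)
    have S_inj: "x = 0" if "(x, 0) \<in> S" for x
    proof -
      have "(x, 0) \<in> S O S"
        using that \<open>(0, 0) \<in> S\<close> by blast
      then have "(x, 0) \<in> range (\<lambda>x. (K x, x))"
        by (simp only: S(3))
      then show ?thesis
        using symmetric_map_zero[OF K(1)] by blast
    qed
    have S_surj: "x \<in> Range S" for x
    proof -
      have "(K x, x) \<in> S O S"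
        by (simp add: S(3))
      then show ?thesis
        by blast
    qed
    obtain P where P: "S = range (\<lambda>x. (P x, x))" "symmetric_map P"
      by (rule selfadjoint_surj_imp_inverse_graph[OF S(1) S_inj S_surj])
    have PP: "P (P x) = K x" for x
    proof -
      have "(P (P x), x) \<in> S O S"
        unfolding P(1) by blast
      then have "(P (P x), x) \<in> range (\<lambda>x. (K x, x))"
        by (simp only: S(3))
      then show ?thesis
        by blast
    qed
    have P_le: "norm (P x) \<le> norm x" for x
      by (rule norm_sqrt_le[OF P(2) PP K_le])
    have P_pos: "0 \<le> Re (cinner x (P x))" for x
    proof -
      have "cinner (P x) x \<in> \<real>\<^sub>\<ge>\<^sub>0"
        using S(2) P(1) by (auto simp: nonneg_op_def)
      then show ?thesis
        by (simp add: symmetric_mapD[OF P(2)] complex_nonneg_Reals_iff)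
    qed
    have Q_le: "norm (Q x) \<le> norm x" for x
      by (rule norm_sqrt_le[OF Q(1) Q(3) K_le])
    \<comment> \<open>\<open>P\<close> commutes with \<open>K\<close> because \<open>K\<close> is
      its square, hence also with \<open>Q\<close>.\<close>
    have "P (Q x) = Q (P x)" for x
      by (rule Q_comm[OF P(2) P_le]) (simp only: PP[symmetric])
    then have "P x = Q x" for x
      by (rule positive_sqrt_unique[OF P(2) P_pos P_le Q(1,2) Q_le, rotated]) (simp add: PP Q(3))
    then show "S = range (\<lambda>x. (Q x, x))"
      using P(1) by simp
  qed
  with Q(1,3) that show thesis
    by blast
qed

section \<open>The operator \<open>(1 + A A\<^sup>*)\<^sup>-\<^sup>1\<close>\<close>

text \<open>Here \<open>k x\<close> is the point of the graph of \<open>A\<^sup>*\<close> over \<open>(1 + A A\<^sup>*)\<^sup>-\<^sup>1 x\<close>. In terms of the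
  graph, which carries the scalar product of \<open>\<H>\<^sub>+\<^sub>1\<close>, it is the orthogonal projection of \<open>(x, 0)\<close>
  and hence the Riesz representative of \<open>x\<close>.\<close>

lemma resolvent_exists:
  fixes Astar :: "('a::chilbert_space \<times> 'a) set"
  assumes "linear_operator Astar" "closed Astar" "densely_defined Astar"
  obtains k where "\<And>x. k x \<in> Astar" "\<And>x z. z \<in> Astar \<Longrightarrow> cinner (k x) z = cinner x (fst z)"
    "\<And>x p. p \<in> Astar \<Longrightarrow> (\<And>z. z \<in> Astar \<Longrightarrow> cinner p z = cinner x (fst z)) \<Longrightarrow> p = k x"
    "\<And>x y. cinner_minus1 Astar x y = cinner (k x) (k y)"
proof -
  have sub: "complex_vector.subspace Astar"
    using assms(1) by (simp add: linear_operator_def)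
  have "\<exists>p\<in>Astar. \<forall>z\<in>Astar. cinner z ((x, 0) - p) = 0" for x
    using orthogonal_projection_exists[OF sub assms(2), of "(x, 0)"] by metis
  then obtain k where k: "\<And>x. k x \<in> Astar" "\<And>x z. z \<in> Astar \<Longrightarrow> cinner z ((x, 0) - k x) = 0"
    by metis
  have riesz: "cinner (k x) z = cinner x (fst z)" if "z \<in> Astar" for x z
  proof -
    have "cinner ((x, 0) - k x) z = 0"
      using k(2)[OF that] cinner_commute_zero by blast
    then show ?thesis
      by (simp add: cinner.diff_left cinner.minus_left cinner_prod_def algebra_simps)
  qed
  have riesz_unique: "p = k x" if "p \<in> Astar" "\<And>z. z \<in> Astar \<Longrightarrow> cinner p z = cinner x (fst z)" for p x
  proof -
    have "p - k x \<in> Astar"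
      using that(1) k(1) subspaceD(3)[OF sub] by blast
    then have "cinner (p - k x) (p - k x) = 0"
      using that(2) riesz by (simp add: cinner.diff_left)
    then show ?thesis
      by (simp add: cinner_eq_zero_iff)
  qed
  define K where "K x = fst (k x)" for x
  have kk: "cinner (k x) (k y) = cinner x (K y)" for x y
    by (simp add: K_def riesz k(1))
  have K_sym: "symmetric_map K"
    unfolding symmetric_map_def by (metis cinner_commute kk)
  have norm_k: "(norm (k x))\<^sup>2 = Re (cinner x (K x))" for x
    by (simp add: kk[symmetric] Re_cinner_self)
  \<comment> \<open>\<open>K x\<close> is a component of \<open>k x\<close>, whose squared norm is
    the quadratic form of \<open>K\<close>; this is the form of contractivity that the square root
    requires.\<close>
  have K_le: "(norm (K x))\<^sup>2 \<le> Re (cinner x (K x))" for x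
  proof -
    have "norm (K x) \<le> norm (k x)"
      unfolding K_def by (metis norm_fst_le prod.collapse)
    then show ?thesis
      by (simp add: power_mono flip: norm_k)
  qed
  have K_inj: "x = 0" if "K x = 0" for x
  proof -
    have "k x = 0"
      using norm_k[of x] that by simp
    then have "cinner x m = 0" if "m \<in> Domain Astar" for m
      using riesz[of _ x] that by fastforce
    moreover have "complex_vector.subspace (Domain Astar)"
      by (rule subspace_Domain[OF sub])
    ultimately show ?thesis
      using assms(3) dense_iff_orthogonal_trivial[of "Domain Astar"]
      by (auto simp: densely_defined_def)
  qed
  \<comment> \<open>If \<open>(f, w)\<close> is in the graph and \<open>A\<close> sends
    \<open>w\<close> to \<open>g\<close>, then \<open>(f, w)\<close> represents the functional of
    \<open>f + g\<close>. Conversely, the Riesz identity for \<open>k x\<close> says that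
    \<open>A\<close> sends its second component to \<open>x - K x\<close>.\<close>
  have "one_plus (Astar O adjoint_op Astar) = range (\<lambda>x. (K x, x))"
  proof (intro equalityI subsetI)
    fix p assume "p \<in> one_plus (Astar O adjoint_op Astar)"
    then obtain f g w where p: "p = (f, f + g)" "(f, w) \<in> Astar" "(w, g) \<in> adjoint_op Astar"
      by (auto simp: one_plus_def)
    have "(f, w) = k (f + g)"
      using p(2,3)
      by (intro riesz_unique) (auto simp: cinner_prod_def cinner_add_left adjoint_op_def)
    then have "f = K (f + g)"
      unfolding K_def by (metis fst_conv)
    then show "p \<in> range (\<lambda>x. (K x, x))"
      using p(1) by blast
  next
    fix p assume "p \<in> range (\<lambda>x. (K x, x))"
    then obtain x where p: "p = (K x, x)"
      by blast
    have "(snd (k x), x - K x) \<in> adjoint_op Astar"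
      using riesz[of _ x]
      by (auto simp: adjoint_op_def cinner_prod_def K_def cinner.diff_left algebra_simps)
    moreover have "(K x, snd (k x)) \<in> Astar"
      using k(1) by (simp add: K_def)
    ultimately have "(K x, K x + (x - K x)) \<in> one_plus (Astar O adjoint_op Astar)"
      unfolding one_plus_def by blast
    then show "p \<in> one_plus (Astar O adjoint_op Astar)"
      by (simp add: p)
  qed
  moreover obtain Q where Q: "symmetric_map Q" "\<And>x. Q (Q x) = K x"
    "sqrt_op (range (\<lambda>x. (K x, x))) = range (\<lambda>x. (Q x, x))"
    using sqrt_op_inverse_graph[OF K_sym K_le K_inj] by blast
  moreover have "op_apply ((range (\<lambda>x. (Q x, x)))\<inverse>) x = Q x" for x
    by (auto simp: op_apply_def)
  ultimately have "cinner_minus1 Astar x y = cinner (k x) (k y)" for x y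
    by (simp add: cinner_minus1_def kk symmetric_mapD[OF Q(1)])
  with k(1) riesz riesz_unique show thesis
    by (rule that)
qed

section \<open>The identification of \<open>\<H>\<^sub>-\<^sub>1\<close> with the dual of \<open>\<H>\<^sub>+\<^sub>1\<close>\<close>

text \<open>The map \<open>k\<close> is isometric for the scalar product of the completion, so it
  extends by limits. The vector \<open>W l\<close> represents the functional \<open>l\<close> with
  respect to the scalar product of the graph.\<close>

lemma dual_identification_exists:
  fixes Astar :: "('a::chilbert_space \<times> 'a) set" and \<iota> :: "'a \<Rightarrow> 'b::chilbert_space"
  assumes "linear_operator Astar" "closed Astar" "densely_defined Astar"
    and completion: "is_completion_minus1 Astar \<iota>"
  obtains W where "range W = Astar" "\<And>l m. cinner (W l) (W m) = cinner l m"
    "\<And>x z. z \<in> Astar \<Longrightarrow> cinner (W (\<iota> x)) z = cinner x (fst z)"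
    "\<And>l z. z \<in> Astar \<Longrightarrow> functional_value \<iota> l (fst z) = cinner (W l) z"
proof -
  have sub: "complex_vector.subspace Astar" and single: "single_valued Astar"
    using assms(1) by (simp_all add: linear_operator_def)
  obtain k where k: "\<And>x. k x \<in> Astar" "\<And>x z. z \<in> Astar \<Longrightarrow> cinner (k x) z = cinner x (fst z)"
    and k_eqI: "\<And>x p. p \<in> Astar \<Longrightarrow> (\<And>z. z \<in> Astar \<Longrightarrow> cinner p z = cinner x (fst z)) \<Longrightarrow> p = k x"
    and k_minus1: "\<And>x y. cinner_minus1 Astar x y = cinner (k x) (k y)"
    by (rule resolvent_exists[OF assms(1-3)]) blast
  have kk: "cinner (\<iota> x) (\<iota> y) = cinner (k x) (k y)" for x y
    using completion k_minus1 by (simp add: is_completion_minus1_def)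
  have isometric: "norm (k x - k y) = norm (\<iota> x - \<iota> y)" for x y
  proof (rule power2_eq_imp_eq)
    have "cinner (k x - k y) (k x - k y) = cinner (\<iota> x - \<iota> y) (\<iota> x - \<iota> y)"
      by (simp add: cinner.diff_left cinner.diff_right kk)
    then show "(norm (k x - k y))\<^sup>2 = (norm (\<iota> x - \<iota> y))\<^sup>2"
      by (simp add: Re_cinner_self[symmetric])
  qed simp_all
  have Cauchy_iff: "Cauchy (\<lambda>n. k (X n)) \<longleftrightarrow> Cauchy (\<lambda>n. \<iota> (X n))" for X
    by (simp add: Cauchy_def dist_norm isometric)
  have approx: "\<exists>X. (\<lambda>n. \<iota> (X n)) \<longlonglongrightarrow> l" for l
  proof -
    have "l \<in> closure (range \<iota>)"
      using completion by (simp add: is_completion_minus1_def)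
    then obtain Y where Y: "\<And>n. Y n \<in> range \<iota>" "Y \<longlonglongrightarrow> l"
      unfolding closure_sequential by blast
    then have "\<forall>n. \<exists>x. Y n = \<iota> x"
      by blast
    then obtain X where "Y = (\<lambda>n. \<iota> (X n))"
      by metis
    with Y(2) show ?thesis
      by blast
  qed
  have "\<exists>p X. (\<lambda>n. \<iota> (X n)) \<longlonglongrightarrow> l \<and> (\<lambda>n. k (X n)) \<longlonglongrightarrow> p" for l
  proof -
    obtain X where X: "(\<lambda>n. \<iota> (X n)) \<longlonglongrightarrow> l"
      using approx by blast
    then have "Cauchy (\<lambda>n. k (X n))"
      by (simp add: Cauchy_iff LIMSEQ_imp_Cauchy)
    with X show ?thesis
      using Cauchy_convergent_iff convergent_def by blast
  qed
  then obtain W X0 where X0: "\<And>l. (\<lambda>n. \<iota> (X0 l n)) \<longlonglongrightarrow> l" "\<And>l. (\<lambda>n. k (X0 l n)) \<longlonglongrightarrow> W l"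
    by metis
  \<comment> \<open>\<open>W l\<close> was chosen along the one sequence \<open>X0 l\<close>; since
    \<open>k\<close> is isometric, every other approximating sequence gives the same limit.\<close>
  have W: "(\<lambda>n. k (X n)) \<longlonglongrightarrow> W l" if X: "(\<lambda>n. \<iota> (X n)) \<longlonglongrightarrow> l" for X l
  proof -
    have "(\<lambda>n. norm (\<iota> (X n) - \<iota> (X0 l n))) \<longlonglongrightarrow> norm (l - l)"
      by (intro tendsto_intros X X0)
    then have "(\<lambda>n. k (X n) - k (X0 l n)) \<longlonglongrightarrow> 0"
      by (simp add: isometric[symmetric] tendsto_norm_zero_iff)
    from tendsto_add[OF this X0(2)[of l]] show ?thesis
      by simp
  qed
  have W_in: "W l \<in> Astar" for l
    using closed_sequentially[OF assms(2) _ X0(2)] k(1) by blast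
  have W_cinner: "cinner (W l) (W m) = cinner l m" for l m
  proof (rule LIMSEQ_unique)
    show "(\<lambda>n. cinner (k (X0 l n)) (k (X0 m n))) \<longlonglongrightarrow> cinner (W l) (W m)"
      by (intro cinner.tendsto X0)
    show "(\<lambda>n. cinner (k (X0 l n)) (k (X0 m n))) \<longlonglongrightarrow> cinner l m"
      unfolding kk[symmetric] by (intro cinner.tendsto X0)
  qed
  have W_\<iota>: "W (\<iota> x) = k x" for x
    using W[of "\<lambda>n. x" "\<iota> x"] by (simp add: LIMSEQ_const_iff)
  have k_dense: "Astar \<subseteq> closure (range k)"
  proof
    have "complex_vector.subspace (range k)"
    proof (rule complex_vector.subspaceI)
      have "0 = k 0"
        by (rule k_eqI) (simp_all add: subspaceD(1)[OF sub])
      then show "0 \<in> range k"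
        by blast
      fix p q assume "p \<in> range k" "q \<in> range k"
      then obtain x y where "p = k x" "q = k y"
        by blast
      then have "p + q = k (x + y)"
        by (intro k_eqI) (simp_all add: cinner_add_left k subspaceD(2)[OF sub])
      then show "p + q \<in> range k"
        by blast
    next
      fix c p assume "p \<in> range k"
      then obtain x where "p = k x"
        by blast
      then have "c *\<^sub>C p = k (c *\<^sub>C x)"
        by (intro k_eqI) (simp_all add: cinner_scaleC_left k subspaceD(4)[OF sub])
      then show "c *\<^sub>C p \<in> range k"
        by blast
    qed
    note sub_k = closure_subspace[OF this]
    have "closure (range k) \<subseteq> Astar"
      using k(1) assms(2) by (intro closure_minimal) auto
    fix p assume "p \<in> Astar"
    then show "p \<in> closure (range k)"
    proof (rule double_orthogonal[OF sub_k closed_closure \<open>closure (range k) \<subseteq> Astar\<close> sub])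
      fix y assume y: "y \<in> Astar" "\<And>m. m \<in> closure (range k) \<Longrightarrow> cinner m y = 0"
      \<comment> \<open>Orthogonality of \<open>y\<close> to \<open>k (fst y)\<close> is, by the
        Riesz identity, exactly this. Single-valuedness then removes the second component.\<close>
      have "cinner (fst y) (fst y) = 0"
        using y(2)[OF closure_subset[THEN subsetD, OF rangeI]] k(2)[OF y(1)] by metis
      then have "fst y = 0"
        by (simp add: cinner_eq_zero_iff)
      with y(1) have "(0, snd y) \<in> Astar" "(0, 0) \<in> Astar"
        using subspaceD(1)[OF sub] by (metis prod.collapse, simp add: zero_prod_def)
      then have "snd y = 0"
        using single by (meson single_valuedD)
      with \<open>fst y = 0\<close> have "y = 0"
        by (simp add: prod_eq_iff)
      then show "cinner y p = 0"
        by simp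
    qed
  qed
  \<comment> \<open>A sequence \<open>k (X n)\<close> tending to \<open>p\<close> is Cauchy, hence
    so is \<iota> along \<open>X\<close>; completeness of the target of \<iota> provides the
    preimage of \<open>p\<close>.\<close>
  have "p \<in> range W" if "p \<in> Astar" for p
  proof -
    have "p \<in> closure (range k)"
      using that k_dense by blast
    then obtain Y where Y: "\<And>n. Y n \<in> range k" "Y \<longlonglongrightarrow> p"
      unfolding closure_sequential by blast
    then have "\<forall>n. \<exists>x. Y n = k x"
      by blast
    then obtain X where "Y = (\<lambda>n. k (X n))"
      by metis
    with Y(2) have X: "(\<lambda>n. k (X n)) \<longlonglongrightarrow> p"
      by blast
    then have "Cauchy (\<lambda>n. \<iota> (X n))"
      by (simp add: Cauchy_iff[symmetric] LIMSEQ_imp_Cauchy)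
    then obtain l where "(\<lambda>n. \<iota> (X n)) \<longlonglongrightarrow> l"
      using Cauchy_convergent_iff convergent_def by blast
    from LIMSEQ_unique[OF X W[OF this]] have "p = W l" .
    then show ?thesis
      by blast
  qed
  then have "range W = Astar"
    using W_in by blast
  moreover have "functional_value \<iota> l (fst z) = cinner (W l) z" if z: "z \<in> Astar" for l z
    unfolding functional_value_def
  proof (rule the_equality)
    have lim: "(\<lambda>n. cinner (X n) (fst z)) \<longlonglongrightarrow> cinner (W l) z" if "(\<lambda>n. \<iota> (X n)) \<longlonglongrightarrow> l" for X
      unfolding k(2)[OF z, symmetric] by (intro cinner.tendsto W that tendsto_const)
    then show "\<forall>X. (\<lambda>n. \<iota> (X n)) \<longlonglongrightarrow> l \<longrightarrow> (\<lambda>n. cinner (X n) (fst z)) \<longlonglongrightarrow> cinner (W l) z"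
      by blast
    fix c assume "\<forall>X. (\<lambda>n. \<iota> (X n)) \<longlonglongrightarrow> l \<longrightarrow> (\<lambda>n. cinner (X n) (fst z)) \<longlonglongrightarrow> c"
    \<comment> \<open>The sequence \<open>X0 l\<close> converges to \<open>l\<close>, so the
      condition on \<open>c\<close> is not vacuous and fixes its value.\<close>
    then show "c = cinner (W l) z"
      using LIMSEQ_unique[OF _ lim[OF X0(1)]] X0(1) by blast
  qed
  ultimately show thesis
    using that[of W] W_cinner W_\<iota> k(2) by simp
qed

section \<open>The correspondence\<close>

theorem corollary3p3:
  fixes Astar :: "('a::chilbert_space \<times> 'a) set"
    and \<iota> :: "'a \<Rightarrow> 'b::chilbert_space"
  assumes "linear_operator Astar"
    and "closed Astar"
    and "densely_defined Astar"
    and "is_completion_minus1 Astar \<iota>"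
  shows "bij_betw (restriction_op Astar \<iota>)
    {L. complex_vector.subspace L \<and> closed L \<and> L \<inter> range \<iota> = {0}}
    {B. linear_operator B \<and> B \<subseteq> Astar \<and> closed B \<and> densely_defined B}"
proof -
  have sub: "complex_vector.subspace Astar" and single: "single_valued Astar"
    using assms(1) by (simp_all add: linear_operator_def)
  obtain W where W: "range W = Astar" "\<And>l m. cinner (W l) (W m) = cinner l m"
    "\<And>x z. z \<in> Astar \<Longrightarrow> cinner (W (\<iota> x)) z = cinner x (fst z)"
    "\<And>l z. z \<in> Astar \<Longrightarrow> functional_value \<iota> l (fst z) = cinner (W l) z"
    using dual_identification_exists[OF assms] by blast
  have restriction_eq: "restriction_op Astar \<iota> L = Astar \<inter> orthogonal_complement (W ` L)" for L
  proof -
    have "restriction_op Astar \<iota> L = {p \<in> Astar. \<forall>l\<in>L. functional_value \<iota> l (fst p) = 0}"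
      by (auto simp: restriction_op_def restriction_domain_def)
    also have "\<dots> = {p \<in> Astar. \<forall>l\<in>L. cinner (W l) p = 0}"
      using W(4) by (metis (no_types, lifting))
    finally show ?thesis
      by (auto simp: orthogonal_complement_def)
  qed
  \<comment> \<open>The candidate inverse is a complement formed inside the completion, which makes
    it a closed subspace at once. For restrictions of \<open>Astar\<close> it consists of the
    functionals that vanish on the domain of \<open>B\<close>.\<close>
  define annihilator where "annihilator B = orthogonal_complement {m. W m \<in> B}" for B
  have annihilator_iff: "l \<in> annihilator B \<longleftrightarrow> (\<forall>p\<in>B. cinner (W l) p = 0)" if "B \<subseteq> Astar" for l B
  proof -
    have "l \<in> annihilator B \<longleftrightarrow> (\<forall>m. W m \<in> B \<longrightarrow> cinner (W l) (W m) = 0)"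
      by (auto simp: annihilator_def orthogonal_complement_def W(2) cinner_commute_zero[of l])
    also have "\<dots> \<longleftrightarrow> (\<forall>p\<in>B. cinner (W l) p = 0)"
      using that W(1) by blast
    finally show ?thesis .
  qed
  have \<iota>_in_annihilator: "\<iota> x \<in> annihilator B \<longleftrightarrow> (\<forall>f\<in>Domain B. cinner x f = 0)"
    if "B \<subseteq> Astar" for x B
    using that W(3)[of _ x] by (auto simp: annihilator_iff subset_eq)
  have \<iota>_zero: "\<iota> 0 = 0"
    using assms(4) module_hom.zero Vector_Spaces.linear.axioms(3)
    unfolding is_completion_minus1_def by blast
  have \<iota>_inj: "x = 0" if "\<iota> x = 0" for x
  proof -
    \<comment> \<open>If \<iota> sends \<open>x\<close> to \<open>0\<close>, then \<open>x\<close>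
      is orthogonal to the whole domain of \<open>Astar\<close>, which is dense.\<close>
    have "\<iota> x \<in> annihilator Astar"
      unfolding that annihilator_def by (intro subspaceD subspace_orthogonal_complement)
    then have "\<forall>f\<in>Domain Astar. cinner x f = 0"
      by (simp only: \<iota>_in_annihilator[OF subset_refl])
    then show ?thesis
      using assms(3) dense_iff_orthogonal_trivial[OF subspace_Domain[OF sub]]
      by (simp add: densely_defined_def)
  qed
  \<comment> \<open>The elements of the range of \<iota> in the annihilator are the images of the
    vectors orthogonal to the domain of \<open>B\<close>; injectivity of \<iota> makes one set
    trivial exactly when the other is.\<close>
  have dense_iff: "densely_defined B \<longleftrightarrow> annihilator B \<inter> range \<iota> = {0}"
    if B: "complex_vector.subspace B" "B \<subseteq> Astar" for B
  proof -
    have "densely_defined B \<longleftrightarrow> (\<forall>x. \<iota> x \<in> annihilator B \<longrightarrow> x = 0)"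
      by (simp only: densely_defined_def dense_iff_orthogonal_trivial[OF subspace_Domain[OF B(1)]]
          \<iota>_in_annihilator[OF B(2)])
    moreover have "0 \<in> annihilator B"
      unfolding annihilator_def by (intro subspaceD subspace_orthogonal_complement)
    ultimately show ?thesis
      using \<iota>_zero \<iota>_inj by auto
  qed
  have annihilator_restriction: "annihilator (restriction_op Astar \<iota> L) = L"
    if L: "complex_vector.subspace L" "closed L" for L
  proof (intro equalityI subsetI)
    fix l assume l: "l \<in> annihilator (restriction_op Astar \<iota> L)"
    show "l \<in> L"
    proof (rule double_orthogonal[OF L subset_UNIV complex_vector.subspace_UNIV UNIV_I])
      fix y assume "\<And>m. m \<in> L \<Longrightarrow> cinner m y = 0"
      then have "W y \<in> restriction_op Astar \<iota> L"
        using W(1) by (auto simp: restriction_eq orthogonal_complement_def W(2))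
      with l have "cinner (W l) (W y) = 0"
        by (auto simp: restriction_eq annihilator_iff)
      then show "cinner y l = 0"
        by (simp add: W(2) cinner_commute_zero)
    qed
  qed (auto simp: restriction_eq annihilator_iff orthogonal_complement_def)
  have restriction_annihilator: "restriction_op Astar \<iota> (annihilator B) = B"
    if B: "complex_vector.subspace B" "closed B" "B \<subseteq> Astar" for B
  proof (intro equalityI subsetI)
    fix p assume p: "p \<in> restriction_op Astar \<iota> (annihilator B)"
    show "p \<in> B"
    \<comment> \<open>Here the complement is taken inside the graph, where every competitor
      \<open>y\<close> is of the form \<open>W l\<close>, and orthogonality of \<open>y\<close> to
      \<open>B\<close> means that \<open>l\<close> is in the annihilator.\<close>
    proof (rule double_orthogonal[OF B sub])
      fix y assume "y \<in> Astar" and y: "\<And>m. m \<in> B \<Longrightarrow> cinner m y = 0"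
      then obtain l where l: "y = W l"
        using W(1) by blast
      then have "l \<in> annihilator B"
        using y by (auto simp: annihilator_iff[OF B(3)] cinner_commute_zero[of "W l"])
      with p l show "cinner y p = 0"
        by (auto simp: restriction_eq orthogonal_complement_def)
    qed (use p in \<open>simp add: restriction_eq\<close>)
  qed (use B(3) in \<open>auto simp: restriction_eq annihilator_iff[OF B(3)] orthogonal_complement_def\<close>)
  show ?thesis
  proof (rule bij_betw_byWitness[where f' = annihilator])
    let ?\<L> = "{L. complex_vector.subspace L \<and> closed L \<and> L \<inter> range \<iota> = {0}}"
    let ?\<B> = "{B. linear_operator B \<and> B \<subseteq> Astar \<and> closed B \<and> densely_defined B}"
    show "\<forall>L\<in>?\<L>. annihilator (restriction_op Astar \<iota> L) = L"
      using annihilator_restriction by blast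
    show "\<forall>B\<in>?\<B>. restriction_op Astar \<iota> (annihilator B) = B"
      using restriction_annihilator by (simp add: linear_operator_def)
    show "restriction_op Astar \<iota> ` ?\<L> \<subseteq> ?\<B>"
    proof clarify
      fix L assume L: "complex_vector.subspace L" "closed L" "L \<inter> range \<iota> = {0}"
      let ?B = "restriction_op Astar \<iota> L"
      have le: "?B \<subseteq> Astar"
        by (simp add: restriction_eq)
      have subB: "complex_vector.subspace ?B"
        unfolding restriction_eq
        by (intro complex_vector.subspace_inter sub subspace_orthogonal_complement)
      moreover have "single_valued ?B"
        using single le single_valued_subset by blast
      moreover have "closed ?B"
        unfolding restriction_eq by (intro closed_Int assms(2) closed_orthogonal_complement)
      moreover have "densely_defined ?B"
        unfolding dense_iff[OF subB le] annihilator_restriction[OF L(1,2)] by (rule L(3))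
      ultimately show "linear_operator ?B \<and> ?B \<subseteq> Astar \<and> closed ?B \<and> densely_defined ?B"
        using le by (simp add: linear_operator_def)
    qed
    show "annihilator ` ?\<B> \<subseteq> ?\<L>"
      using dense_iff
      by (auto simp: linear_operator_def annihilator_def subspace_orthogonal_complement
          closed_orthogonal_complement)
  qed
qed

end
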